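(* Let $\{A(t)\}_{t\ge0}$ satisfy the Acquistapace–Terreni conditions on $\mathbb{R}^+$ with associated evolution family $U(t,s)$, suppose $(t,s)\mapsto U(t,s)x$ is Bi-almost automorphic uniformly for $x$ in bounded subsets of $\mathbb{X}$, and suppose $\|U(t,s)\|\le Me^{-\delta(t-s)}$ for $t\ge s\ge0$ with constants $M,\delta>0$. Let $B(t,s)$, $t\ge s\ge0$, be linear operators on $\mathbb{X}$, $\mathcal{B}u(t)=\int_0^tB(t,s)u(s)\,ds$, $C_B=\sup_{s\ge0}\int_0^s\|B(s,\tau)\|\,d\tau<\infty$. Let $F\in AAA(\mathbb{R}^+\times\mathbb{X}\times\mathbb{X};\mathbb{X})$ be $L_F$-Lipschitz, i.e. $\|F(t,x,z)-F(t,x',z')\|\le L_F(\|x-x'\|+\|z-z'\|)$. Let $u_0\in\mathbb{X}$, $\rho>0$, $h:AAA(\mathbb{R}^+;\mathbb{X})\to\mathbb{X}$ and $$\Delta_0=\{y\in AAA(\mathbb{R}^+;\mathbb{X}):\|y-y_0\|_\infty\le\rho\},\qquad y_0(t)=U(t,0)(u_0+h(0))+\int_0^tU(t,s)F(s,0,0)\,ds,$$ and suppose $h$ is $L_h$-Lipschitz on $\Delta_0$. Let $\Gamma:AAA(\mathbb{R}^+;\mathbb{X})\to AAA(\mathbb{R}^+;\mathbb{X})$ be the operator $$\Gamma y(t)=U(t,0)(u_0+h(y))+\int_0^tU(t,s)F(s,y(s),\mathcal{B}y(s))\,ds ,$$ and put $\xi_0:=ML_h+\dfrac{M}{\delta}L_F(1+C_B)$.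 Suppose that $$0<\theta=(1-\xi_0)^{-1}\|\Gamma y_0-y_0\|_\infty\le\rho .$$ Then the problem $$u'(t)=A(t)u(t)+F(t,u(t),\mathcal{B}u(t)),\ t\ge0,\qquad u(0)=u_0+h(u),$$ has a unique mild solution $y\in AAA(\mathbb{R}^+;\mathbb{X})$ such that $\|y-y_0\|_\infty\le\rho$.
   Context: $\mathbb{X}$ is a Banach space, $\mathbb{R}^+=[0,+\infty)$, $\|\cdot\|_\infty$ is the supremum norm. $AA(\mathbb{R};\mathbb{X})$: bounded continuous $f:\mathbb{R}\to\mathbb{X}$ such that every real sequence has a subsequence $(s_n)$ and a function $\tilde f$ with $\lim_n f(t+s_n)=\tilde f(t)$, $\lim_n\tilde f(t-s_n)=f(t)$ for each $t$. $AA(\mathbb{R}\times\mathbb{Y};\mathbb{X})$: bounded continuous $f:\mathbb{R}\times\mathbb{Y}\to\mathbb{X}$ such that for every bounded $\mathcal{D}\subset\mathbb{Y}$ and every real sequence there are a subsequence $(s_n)$ and $\tilde f$ with $\lim_n f(t+s_n,x)=\tilde f(t,x)$, $\lim_n\tilde f(t-s_n,x)=f(t,x)$, pointwise in $t$, uniformly for $x\in\mathcal{D}$. $C_0(\mathbb{R}^+;\mathbb{X})$: continuous functions with norm tending to $0$ at $+\infty$; $C_0(\mathbb{R}^+\times\mathbb{Y};\mathbb{X})$: continuous $\phi$ with $\|\phi(t,y)\|\to0$ as $t\to+\infty$ uniformly on bounded subsets of $\mathbb{Y}$. $AAA(\mathbb{R}^+;\mathbb{X})$ (resp. $AAA(\mathbb{R}^+\times\mathbb{Y};\mathbb{X})$),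 the asymptotically almost automorphic functions: continuous $g=f+\phi$ with $f\in AA(\mathbb{R};\mathbb{X})$, $\phi\in C_0(\mathbb{R}^+;\mathbb{X})$ (resp. $f\in AA(\mathbb{R}\times\mathbb{Y};\mathbb{X})$, $\phi\in C_0(\mathbb{R}^+\times\mathbb{Y};\mathbb{X})$). Acquistapace–Terreni conditions: $A(t):D(A(t))\subset\mathbb{X}\to\mathbb{X}$ are linear and there are constants $\lambda_0\ge0$, $\theta\in(\pi/2,\pi)$, $K_1,K_2\ge0$, $\beta_1,\beta_2\in(0,1]$ with $\beta_1+\beta_2>1$ such that for $t,s\in\mathbb{R}^+$ and $\lambda\in\Sigma_\theta=\{\lambda\in\mathbb{C}\setminus\{0\}:|\arg\lambda|\le\theta\}$: $\Sigma_\theta\cup\{0\}\subset\rho(A(t)-\lambda_0)$, $\|R(\lambda,A(t)-\lambda_0)\|\le\frac{K_1}{1+|\lambda|}$, and $\|(A(t)-\lambda_0)R(\lambda,A(t)-\lambda_0)[R(\lambda_0,A(t))-R(\lambda_0,A(s))]\|\le K_2|t-s|^{\beta_1}|\lambda|^{-\beta_2}$ (this $\theta$ is unrelated to the $\theta$ of the claim). Under these there is a unique evolution family $U(t,s)$, $t\ge s\ge0$, governing $x'(t)=A(t)x(t)$: bounded operators with $U(t,t)=I$, $U(t,s)U(s,r)=U(t,r)$ for $t\ge s\ge r$, strongly continuous in $(t,s)$. $(t,s)\mapsto U(t,s)x$ Bi-almost automorphic uniformly on bounded sets: it is jointly continuous and for every real sequence and every bounded $\mathcal{D}\subset\mathbb{X}$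 there is a subsequence $(s_n)$ with $\tilde U(t,s)x:=\lim_n U(t+s_n,s+s_n)x$ existing and $\lim_n\tilde U(t-s_n,s-s_n)x=U(t,s)x$ for each $(t,s)$ (understood for $t\ge s$, where $U$ is defined), uniformly for $x\in\mathcal{D}$. Mild solution: a continuous $u:[0,+\infty)\to\mathbb{X}$ with $u(t)=U(t,0)(u_0+h(u))+\int_0^tU(t,s)F(s,u(s),\mathcal{B}u(s))\,ds$. $h$ is $L_h$-Lipschitz on $\Delta_0$: $\|h(x)-h(y)\|\le L_h\|x-y\|_\infty$ for $x,y\in\Delta_0$. *)

theory Defs
  imports "HOL-Analysis.Analysis"
begin

section \<open>Complex Banach spaces and operator norms\<close>

text \<open>Resolvents at complex points require complex scalars; this class adds them to the library's
  (real) Banach spaces, compatibly with the real structure and with a homogeneous norm.\<close>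

class complex_banach = banach +
  fixes scaleC :: "complex \<Rightarrow> 'a \<Rightarrow> 'a"  (infixr \<open>*\<^sub>C\<close> 75)
  assumes scaleC_add_right: "a *\<^sub>C (x + y) = a *\<^sub>C x + a *\<^sub>C y"
    and scaleC_add_left: "(a + b) *\<^sub>C x = a *\<^sub>C x + b *\<^sub>C x"
    and scaleC_scaleC: "a *\<^sub>C (b *\<^sub>C x) = (a * b) *\<^sub>C x"
    and scaleC_of_real: "complex_of_real r *\<^sub>C x = r *\<^sub>R x"
    and norm_scaleC: "norm (a *\<^sub>C x) = cmod a * norm x"

instantiation complex :: complex_banach
begin

definition scaleC_complex :: "complex \<Rightarrow> complex \<Rightarrow> complex" where
  "scaleC_complex a x = a * x"

instance
  by standard
    (simp_all add: scaleC_complex_def algebra_simps norm_mult scaleR_conv_of_real)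

end

interpretation complex_vector:
  vector_space "scaleC :: complex \<Rightarrow> 'a \<Rightarrow> 'a::complex_banach"
proof
  show "1 *\<^sub>C x = x" for x :: 'a
    using scaleC_of_real[of 1 x] by simp
qed (simp_all add: scaleC_add_right scaleC_add_left scaleC_scaleC)

text \<open>Operator norm of a linear operator with values in $[0,\infty]$, so that it is meaningful
  without assuming boundedness (the real-valued \<^const>\<open>onorm\<close> is used for bounded operators).\<close>

definition op_ennorm :: "('a::real_normed_vector \<Rightarrow> 'b::real_normed_vector) \<Rightarrow> ennreal" where
  "op_ennorm T = (SUP x. ennreal (norm (T x) / norm x))"

lemma op_ennorm_bounded_linear:
  assumes "bounded_linear T"
  shows "op_ennorm T = ennreal (onorm T)"
proof (rule antisym)
  show "op_ennorm T \<le> ennreal (onorm T)"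
    unfolding op_ennorm_def
    by (rule SUP_least, rule ennreal_leI, rule le_onorm[OF assms])
  have le: "ennreal (norm (T x) / norm x) \<le> op_ennorm T" for x
    unfolding op_ennorm_def by (rule SUP_upper) simp
  show "ennreal (onorm T) \<le> op_ennorm T"
  proof (cases "op_ennorm T = \<infinity>")
    case False
    then obtain r where r: "op_ennorm T = ennreal r" "0 \<le> r"
      by (cases "op_ennorm T") auto
    have "norm (T x) / norm x \<le> r" for x
      using le[of x] r by (simp add: ennreal_le_iff)
    then have "onorm T \<le> r"
      unfolding onorm_def by (intro cSUP_least) auto
    with r show ?thesis by (simp add: ennreal_leI)
  qed simp
qed

section \<open>Almost automorphic functions\<close>

definition almost_automorphic :: "(real \<Rightarrow> 'a::banach) \<Rightarrow> bool" where
  "almost_automorphic f \<longleftrightarrow>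
     continuous_on UNIV f \<and> bounded (range f) \<and>
     (\<forall>\<sigma> :: nat \<Rightarrow> real. \<exists>r g. strict_mono r \<and>
        (\<forall>t. (\<lambda>n. f (t + \<sigma> (r n))) \<longlonglongrightarrow> g t \<and>
             (\<lambda>n. g (t - \<sigma> (r n))) \<longlonglongrightarrow> f t))"

definition almost_automorphic_param ::
    "(real \<Rightarrow> 'y::real_normed_vector \<Rightarrow> 'a::banach) \<Rightarrow> bool" where
  "almost_automorphic_param f \<longleftrightarrow>
     continuous_on UNIV (\<lambda>(t, y). f t y) \<and> bounded (range (\<lambda>(t, y). f t y)) \<and>
     (\<forall>K. bounded K \<longrightarrow>
       (\<forall>\<sigma> :: nat \<Rightarrow> real. \<exists>r g. strict_mono r \<and>
          (\<forall>t. uniform_limit K (\<lambda>n y. f (t + \<sigma> (r n)) y) (\<lambda>y. g t y) sequentially \<and>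
               uniform_limit K (\<lambda>n y. g (t - \<sigma> (r n)) y) (\<lambda>y. f t y) sequentially)))"

definition C0 :: "(real \<Rightarrow> 'a::banach) \<Rightarrow> bool" where
  "C0 \<phi> \<longleftrightarrow> continuous_on {0..} \<phi> \<and> ((\<lambda>t. norm (\<phi> t)) \<longlongrightarrow> 0) at_top"

definition C0_param :: "(real \<Rightarrow> 'y::real_normed_vector \<Rightarrow> 'a::banach) \<Rightarrow> bool" where
  "C0_param \<phi> \<longleftrightarrow>
     continuous_on ({0..} \<times> UNIV) (\<lambda>(t, y). \<phi> t y) \<and>
     (\<forall>K. bounded K \<longrightarrow> uniform_limit K (\<lambda>t y. norm (\<phi> t y)) (\<lambda>y. 0) at_top)"

text \<open>Functions on $[0,\infty)$ are represented by total functions that are \<^const>\<open>extensional\<close>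
  on \<open>{0..}\<close>, so that equality in \<open>AAA\<close> is equality on $[0,\infty)$ and maps on \<open>AAA\<close>
  cannot depend on values at negative arguments.\<close>

definition AAA :: "(real \<Rightarrow> 'a::banach) set" where
  "AAA = {g \<in> extensional {0..}. continuous_on {0..} g \<and>
     (\<exists>f \<phi>. almost_automorphic f \<and> C0 \<phi> \<and> (\<forall>t\<ge>0. g t = f t + \<phi> t))}"

definition AAA_param :: "(real \<Rightarrow> 'y::real_normed_vector \<Rightarrow> 'a::banach) \<Rightarrow> bool" where
  "AAA_param g \<longleftrightarrow> continuous_on ({0..} \<times> UNIV) (\<lambda>(t, y). g t y) \<and>
     (\<exists>f \<phi>. almost_automorphic_param f \<and> C0_param \<phi> \<and>
        (\<forall>t\<ge>0. \<forall>y. g t y = f t y + \<phi> t y))"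

definition zero_fun :: "real \<Rightarrow> 'a::banach" where
  "zero_fun = (\<lambda>t\<in>{0..}. 0)"

text \<open>$\|f-g\|_\infty$ on $[0,\infty)$; used only where the difference is bounded.\<close>

definition sup_dist :: "(real \<Rightarrow> 'a::banach) \<Rightarrow> (real \<Rightarrow> 'a) \<Rightarrow> real" where
  "sup_dist f g = (SUP t\<in>{0..}. norm (f t - g t))"

section \<open>Unbounded operators and the Acquistapace--Terreni conditions\<close>

text \<open>An operator is a pair of a domain and a function whose values off the domain are
  irrelevant.\<close>

definition linear_operator :: "'a::complex_banach set \<Rightarrow> ('a \<Rightarrow> 'a) \<Rightarrow> bool" where
  "linear_operator D T \<longleftrightarrow> complex_vector.subspace D \<and>
     (\<forall>x\<in>D. \<forall>y\<in>D. T (x + y) = T x + T y) \<and>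
     (\<forall>x\<in>D. \<forall>c. T (c *\<^sub>C x) = c *\<^sub>C T x)"

definition resolvent :: "'a::complex_banach set \<Rightarrow> ('a \<Rightarrow> 'a) \<Rightarrow> complex \<Rightarrow> 'a \<Rightarrow> 'a" where
  "resolvent D T z = inv_into D (\<lambda>x. z *\<^sub>C x - T x)"

definition resolvent_set :: "'a::complex_banach set \<Rightarrow> ('a \<Rightarrow> 'a) \<Rightarrow> complex set" where
  "resolvent_set D T =
     {z. bij_betw (\<lambda>x. z *\<^sub>C x - T x) D UNIV \<and> bounded_linear (resolvent D T z)}"

definition sector :: "real \<Rightarrow> complex set" where
  "sector \<theta> = {z. z \<noteq> 0 \<and> \<bar>Arg z\<bar> \<le> \<theta>}"

definition shifted_op :: "real \<Rightarrow> ('a::complex_banach \<Rightarrow> 'a) \<Rightarrow> 'a \<Rightarrow> 'a" where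
  "shifted_op c T = (\<lambda>x. T x - c *\<^sub>R x)"

definition acquistapace_terreni ::
    "(real \<Rightarrow> 'a::complex_banach set) \<Rightarrow> (real \<Rightarrow> 'a \<Rightarrow> 'a) \<Rightarrow> bool" where
  "acquistapace_terreni D A \<longleftrightarrow>
     (\<forall>t\<ge>0. linear_operator (D t) (A t)) \<and>
     (\<exists>c \<theta> K1 K2 \<beta>1 \<beta>2 :: real.
        0 \<le> c \<and> pi / 2 < \<theta> \<and> \<theta> < pi \<and> 0 \<le> K1 \<and> 0 \<le> K2 \<and>
        0 < \<beta>1 \<and> \<beta>1 \<le> 1 \<and> 0 < \<beta>2 \<and> \<beta>2 \<le> 1 \<and> 1 < \<beta>1 + \<beta>2 \<and>
        (\<forall>t\<ge>0. sector \<theta> \<union> {0} \<subseteq> resolvent_set (D t) (shifted_op c (A t))) \<and>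
        (\<forall>t\<ge>0. \<forall>z\<in>sector \<theta>.
           onorm (resolvent (D t) (shifted_op c (A t)) z) \<le> K1 / (1 + cmod z)) \<and>
        (\<forall>t\<ge>0. \<forall>s\<ge>0. \<forall>z\<in>sector \<theta>.
           onorm (\<lambda>x. shifted_op c (A t) (resolvent (D t) (shifted_op c (A t)) z
               (resolvent (D t) (A t) (of_real c) x - resolvent (D s) (A s) (of_real c) x)))
             \<le> K2 * \<bar>t - s\<bar> powr \<beta>1 * cmod z powr (- \<beta>2)))"

section \<open>Evolution families\<close>

text \<open>\<open>U t s\<close> is meaningful only for \<open>0 \<le> s \<le> t\<close>.\<close>

definition evolution_family :: "(real \<Rightarrow> real \<Rightarrow> 'a::complex_banach \<Rightarrow> 'a) \<Rightarrow> bool" where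
  "evolution_family U \<longleftrightarrow>
     (\<forall>s\<ge>0. \<forall>t\<ge>s. linear_operator UNIV (U t s) \<and> bounded_linear (U t s)) \<and>
     (\<forall>t\<ge>0. \<forall>x. U t t x = x) \<and>
     (\<forall>r\<ge>0. \<forall>s\<ge>r. \<forall>t\<ge>s. \<forall>x. U t s (U s r x) = U t r x) \<and>
     (\<forall>x. continuous_on {(t, s). 0 \<le> s \<and> s \<le> t} (\<lambda>(t, s). U t s x))"

text \<open>\<open>U\<close> governs $x'(t)=A(t)x(t)$: for every \<open>s \<ge> 0\<close> and \<open>x\<close> the orbit \<open>t \<mapsto> U t s x\<close>
  (continuous on \<open>{s..}\<close> and equal to \<open>x\<close> at \<open>s\<close>, by \<open>evolution_family\<close>) is a solution of the
  equation on \<open>{s<..}\<close>. Under the Acquistapace--Terreni conditions this determines \<open>U\<close>.\<close>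

definition governs ::
    "(real \<Rightarrow> real \<Rightarrow> 'a::complex_banach \<Rightarrow> 'a) \<Rightarrow>
     (real \<Rightarrow> 'a set) \<Rightarrow> (real \<Rightarrow> 'a \<Rightarrow> 'a) \<Rightarrow> bool" where
  "governs U D A \<longleftrightarrow> evolution_family U \<and>
     (\<forall>s\<ge>0. \<forall>t>s. \<forall>x. U t s x \<in> D t \<and>
        ((\<lambda>\<tau>. U \<tau> s x) has_vector_derivative A t (U t s x)) (at t))"

definition bi_almost_automorphic ::
    "(real \<Rightarrow> real \<Rightarrow> 'a::banach \<Rightarrow> 'a) \<Rightarrow> bool" where
  "bi_almost_automorphic V \<longleftrightarrow>
     (\<forall>x. continuous_on {(t, s). s \<le> t} (\<lambda>(t, s). V t s x)) \<and>
     (\<forall>\<sigma> :: nat \<Rightarrow> real. \<forall>K. bounded K \<longrightarrow>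
       (\<exists>r W. strict_mono r \<and>
          (\<forall>t s. s \<le> t \<longrightarrow>
             uniform_limit K (\<lambda>n x. V (t + \<sigma> (r n)) (s + \<sigma> (r n)) x) (W t s) sequentially \<and>
             uniform_limit K (\<lambda>n x. W (t - \<sigma> (r n)) (s - \<sigma> (r n)) x) (V t s) sequentially)))"

text \<open>Translation by arbitrary real sequences leaves the quadrant \<open>s \<ge> 0\<close>, so for a family
  defined for \<open>0 \<le> s \<le> t\<close> the property refers to an extension to all real \<open>s \<le> t\<close>. Such an
  extension is unique: for $\sigma_n\to\infty$ both limits only involve values on the quadrant.\<close>

definition bi_almost_automorphic_halfline ::
    "(real \<Rightarrow> real \<Rightarrow> 'a::banach \<Rightarrow> 'a) \<Rightarrow> bool" where
  "bi_almost_automorphic_halfline U \<longleftrightarrow>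
     (\<exists>V. bi_almost_automorphic V \<and> (\<forall>s\<ge>0. \<forall>t\<ge>s. V t s = U t s))"

section \<open>The integro-differential problem\<close>

text \<open>Integrals of vector-valued functions are Henstock--Kurzweil integrals, since the library's
  Bochner integral exists only for second countable spaces. Every Bochner integrable function on a
  compact interval is integrable in this sense with the same value.\<close>

definition volterra_op ::
    "(real \<Rightarrow> real \<Rightarrow> 'a::banach \<Rightarrow> 'a) \<Rightarrow> (real \<Rightarrow> 'a) \<Rightarrow> real \<Rightarrow> 'a" where
  "volterra_op B u t = integral {0..t} (\<lambda>s. B t s (u s))"

definition C_B :: "(real \<Rightarrow> real \<Rightarrow> 'a::banach \<Rightarrow> 'a) \<Rightarrow> ennreal" where
  "C_B B = (SUP s\<in>{0..}. \<integral>\<^sup>+ \<tau>. op_ennorm (B s \<tau>) \<partial>lebesgue_on {0..s})"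

text \<open>Existence of the integrals in $\mathcal{B}u(t)$ and in the variation of constants
  formula (a nonexistent \<^const>\<open>integral\<close> has the junk value 0).\<close>

definition integrals_exist ::
    "(real \<Rightarrow> real \<Rightarrow> 'a::banach \<Rightarrow> 'a) \<Rightarrow> (real \<Rightarrow> real \<Rightarrow> 'a \<Rightarrow> 'a) \<Rightarrow>
     (real \<Rightarrow> 'a \<Rightarrow> 'a \<Rightarrow> 'a) \<Rightarrow> (real \<Rightarrow> 'a) \<Rightarrow> bool" where
  "integrals_exist U B F u \<longleftrightarrow> (\<forall>t\<ge>0.
     (\<lambda>s. B t s (u s)) integrable_on {0..t} \<and>
     (\<lambda>s. U t s (F s (u s) (volterra_op B u s))) integrable_on {0..t})"

definition Gamma_op ::
    "(real \<Rightarrow> real \<Rightarrow> 'a::banach \<Rightarrow> 'a) \<Rightarrow> (real \<Rightarrow> real \<Rightarrow> 'a \<Rightarrow> 'a) \<Rightarrow>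
     (real \<Rightarrow> 'a \<Rightarrow> 'a \<Rightarrow> 'a) \<Rightarrow> ((real \<Rightarrow> 'a) \<Rightarrow> 'a) \<Rightarrow> 'a \<Rightarrow> (real \<Rightarrow> 'a) \<Rightarrow> real \<Rightarrow> 'a" where
  "Gamma_op U B F h u0 y = (\<lambda>t\<in>{0..}.
     U t 0 (u0 + h y) + integral {0..t} (\<lambda>s. U t s (F s (y s) (volterra_op B y s))))"

definition y_zero ::
    "(real \<Rightarrow> real \<Rightarrow> 'a::banach \<Rightarrow> 'a) \<Rightarrow> (real \<Rightarrow> 'a \<Rightarrow> 'a \<Rightarrow> 'a) \<Rightarrow>
     ((real \<Rightarrow> 'a) \<Rightarrow> 'a) \<Rightarrow> 'a \<Rightarrow> real \<Rightarrow> 'a" where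
  "y_zero U F h u0 = (\<lambda>t\<in>{0..}.
     U t 0 (u0 + h zero_fun) + integral {0..t} (\<lambda>s. U t s (F s 0 0)))"

definition Delta0 :: "(real \<Rightarrow> 'a::banach) \<Rightarrow> real \<Rightarrow> (real \<Rightarrow> 'a) set" where
  "Delta0 y0 \<rho> = {y \<in> AAA. sup_dist y y0 \<le> \<rho>}"

definition mild_solution ::
    "(real \<Rightarrow> real \<Rightarrow> 'a::banach \<Rightarrow> 'a) \<Rightarrow> (real \<Rightarrow> real \<Rightarrow> 'a \<Rightarrow> 'a) \<Rightarrow>
     (real \<Rightarrow> 'a \<Rightarrow> 'a \<Rightarrow> 'a) \<Rightarrow> ((real \<Rightarrow> 'a) \<Rightarrow> 'a) \<Rightarrow> 'a \<Rightarrow> (real \<Rightarrow> 'a) \<Rightarrow> bool" where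
  "mild_solution U B F h u0 u \<longleftrightarrow>
     continuous_on {0..} u \<and> integrals_exist U B F u \<and>
     (\<forall>t\<ge>0. u t =
        U t 0 (u0 + h u) + integral {0..t} (\<lambda>s. U t s (F s (u s) (volterra_op B u s))))"

end

theory Submission
  imports Defs "HOL-Library.Diagonal_Subsequence"
begin

text \<open>Since the operators \<open>B t s\<close> are linear, $y_0=\Gamma(0)$, so $y_0$ lies in \<^const>\<open>AAA\<close>. As
  $\Gamma y_0-y_0$ is bounded, $\theta>0$ forces $\xi_0<1$. The estimates for \<open>U\<close>, \<open>B\<close>, \<open>F\<close> and
  \<open>h\<close> give $\|\Gamma y-\Gamma z\|_\infty\le\xi_0\|y-z\|_\infty$ on $\Delta_0$, hence
  $\|\Gamma y-y_0\|_\infty\le\xi_0\rho+(1-\xi_0)\theta\le\rho$ there, and the contraction principle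
  applies once $\Delta_0$ is known to be complete. For the completeness of \<^const>\<open>AAA\<close>, the
  almost automorphic part of $g=f+\phi$ satisfies $\sup_{\mathbb{R}}\|f\|\le\sup_{t\ge0}\|g(t)\|$
  (translate along $\sigma_k=k$), so a Cauchy sequence in \<^const>\<open>AAA\<close> has Cauchy components.\<close>

section \<open>Almost automorphic functions under uniform limits\<close>

lemma almost_automorphic_subseq:
  assumes "almost_automorphic f"
  obtains r g where "strict_mono (r :: nat \<Rightarrow> nat)"
    "\<And>t. (\<lambda>n. f (t + \<sigma> (r n))) \<longlonglongrightarrow> g t" "\<And>t. (\<lambda>n. g (t - \<sigma> (r n))) \<longlonglongrightarrow> f t"
  using assms unfolding almost_automorphic_def by meson

text \<open>The second subsequence is extracted from the first, so one composed subsequence serves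
  both functions. Applied to two members of a sequence, this makes
  \<open>almost_automorphic_norm_le\<close> a Cauchy estimate.\<close>

lemma almost_automorphic_diff:
  assumes f: "almost_automorphic f" and g: "almost_automorphic g"
  shows "almost_automorphic (\<lambda>t. f t - g t)"
  unfolding almost_automorphic_def
proof (intro conjI allI)
  show "continuous_on UNIV (\<lambda>t. f t - g t)"
    using f g by (auto simp: almost_automorphic_def intro: continuous_intros)
  show "bounded (range (\<lambda>t. f t - g t))"
    using f g by (auto simp: almost_automorphic_def intro: bounded_minus_comp)
  fix \<sigma> :: "nat \<Rightarrow> real"
  obtain r f' where r: "strict_mono r"
    and f': "\<And>t. (\<lambda>n. f (t + \<sigma> (r n))) \<longlonglongrightarrow> f' t" "\<And>t. (\<lambda>n. f' (t - \<sigma> (r n))) \<longlonglongrightarrow> f t"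
    using almost_automorphic_subseq[OF f] by blast
  obtain q g' where q: "strict_mono q"
    and g': "\<And>t. (\<lambda>n. g (t + (\<sigma> \<circ> r) (q n))) \<longlonglongrightarrow> g' t"
      "\<And>t. (\<lambda>n. g' (t - (\<sigma> \<circ> r) (q n))) \<longlonglongrightarrow> g t"
    using almost_automorphic_subseq[OF g] by blast
  have "strict_mono (r \<circ> q)"
    using r q by (rule strict_mono_o)
  moreover have "(\<lambda>n. f (t + \<sigma> ((r \<circ> q) n)) - g (t + \<sigma> ((r \<circ> q) n))) \<longlonglongrightarrow> f' t - g' t" for t
    using tendsto_diff[OF LIMSEQ_subseq_LIMSEQ[OF f'(1) q] g'(1)] by (simp add: o_def)
  moreover have "(\<lambda>n. f' (t - \<sigma> ((r \<circ> q) n)) - g' (t - \<sigma> ((r \<circ> q) n))) \<longlonglongrightarrow> f t - g t" for t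
    using tendsto_diff[OF LIMSEQ_subseq_LIMSEQ[OF f'(2) q] g'(2)] by (simp add: o_def)
  ultimately show "\<exists>r h. strict_mono r \<and> (\<forall>t. (\<lambda>n. f (t + \<sigma> (r n)) - g (t + \<sigma> (r n))) \<longlonglongrightarrow> h t \<and>
      (\<lambda>n. h (t - \<sigma> (r n))) \<longlonglongrightarrow> f t - g t)"
    by (intro exI[of _ "r \<circ> q"] exI[of _ "\<lambda>t. f' t - g' t"]) blast
qed

lemma almost_automorphic_const: "almost_automorphic (\<lambda>t. c)"
  unfolding almost_automorphic_def
  by (auto intro!: exI[of _ id] exI[of _ "\<lambda>_. c"] simp: strict_mono_id)

text \<open>Translating by integers tending to infinity kills \<open>\<phi>\<close>, so the limit
  \<open>g\<close> of the translates of \<open>f\<close> inherits the bound \<open>c\<close> at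
  every real point. Translating \<open>g\<close> back recovers \<open>f\<close> and carries the
  bound to negative arguments as well.\<close>

lemma almost_automorphic_norm_le:
  assumes f: "almost_automorphic f" and \<phi>: "C0 \<phi>"
    and le: "\<And>t. t \<ge> 0 \<Longrightarrow> norm (f t + \<phi> t) \<le> c"
  shows "norm (f t) \<le> c"
proof -
  obtain r g where r: "strict_mono r"
    and g: "\<And>t. (\<lambda>n. f (t + real (r n))) \<longlonglongrightarrow> g t" "\<And>t. (\<lambda>n. g (t - real (r n))) \<longlonglongrightarrow> f t"
    using almost_automorphic_subseq[OF f] by blast
  have "norm (g t) \<le> c" for t
  proof (rule tendsto_upperbound)
    have top: "filterlim (\<lambda>n. t + real (r n)) at_top sequentially"
      by (intro filterlim_tendsto_add_at_top[OF tendsto_const]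
          filterlim_compose[OF filterlim_real_sequentially] filterlim_subseq r)
    have "(\<phi> \<longlongrightarrow> 0) at_top"
      using \<phi> by (simp add: C0_def tendsto_norm_zero_iff)
    then have "(\<lambda>n. \<phi> (t + real (r n))) \<longlonglongrightarrow> 0"
      using top by (rule filterlim_compose)
    then show "(\<lambda>n. norm (f (t + real (r n)) + \<phi> (t + real (r n)))) \<longlonglongrightarrow> norm (g t)"
      using tendsto_norm[OF tendsto_add[OF g(1)]] by fastforce
    have "\<forall>\<^sub>F n in sequentially. t + real (r n) \<ge> 0"
      using top by (simp add: filterlim_at_top)
    then show "\<forall>\<^sub>F n in sequentially. norm (f (t + real (r n)) + \<phi> (t + real (r n))) \<le> c"
      by eventually_elim (rule le)
  qed simp
  then show ?thesis
    by (intro tendsto_upperbound[OF tendsto_norm[OF g(2)]]) auto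
qed

text \<open>A diagonal argument gives one subsequence that works for every \<open>f k\<close>. The
  translation limits of the \<open>f k\<close> then converge uniformly, and both defining limits for
  \<open>l\<close> follow by exchanging the limit in \<open>k\<close> with the one along the
  subsequence.\<close>

lemma almost_automorphic_uniform_limit:
  fixes f :: "nat \<Rightarrow> real \<Rightarrow> 'a::banach"
  assumes f: "\<And>n. almost_automorphic (f n)" and lim: "uniform_limit UNIV f l sequentially"
  shows "almost_automorphic l"
  unfolding almost_automorphic_def
proof (intro conjI allI)
  show "continuous_on UNIV l"
    using f lim by (intro uniform_limit_theorem[of UNIV f]) (auto simp: almost_automorphic_def)
  obtain N where N: "\<And>t. dist (f N t) (l t) < 1"
    using lim unfolding uniform_limit_iff eventually_sequentially
    by (metis UNIV_I order_refl zero_less_one)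
  obtain b where b: "\<And>t. norm (f N t) \<le> b"
    using f[of N] by (auto simp: almost_automorphic_def bounded_iff)
  have "norm (l t) \<le> b + 1" for t
    using N[of t] b[of t] norm_triangle_sub[of "l t" "f N t"]
    by (simp add: dist_norm norm_minus_commute)
  then show "bounded (range l)"
    by (auto simp: bounded_iff)
next
  fix \<sigma> :: "nat \<Rightarrow> real"
  \<comment> \<open>\<open>P k s\<close> says that \<open>\<sigma> \<circ> s\<close> already has
    both translation limits for \<open>f k\<close>; it passes to further subsequences, as
    diagonalisation requires.\<close>
  define P where "P k s \<longleftrightarrow> (\<exists>g. \<forall>t. (\<lambda>n. f k (t + \<sigma> (s n))) \<longlonglongrightarrow> g t \<and>
      (\<lambda>n. g (t - \<sigma> (s n))) \<longlonglongrightarrow> f k t)" for k and s :: "nat \<Rightarrow> nat"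
  interpret subseqs P
  proof
    fix k and s :: "nat \<Rightarrow> nat"
    show "\<exists>r. strict_mono r \<and> P k (s \<circ> r)"
      using almost_automorphic_subseq[OF f[of k], where \<sigma> = "\<sigma> \<circ> s"] unfolding P_def o_def by metis
  qed
  \<comment> \<open>The diagonal sequence is a subsequence of the one chosen for \<open>k\<close>
    only from some index on, hence the shift by \<open>Suc k\<close>; \<open>LIMSEQ_offset\<close>
    removes it below.\<close>
  have P_diag: "P k (diagseq \<circ> (+) (Suc k))" for k
  proof (rule diagseq_holds)
    fix r s :: "nat \<Rightarrow> nat" and n
    assume "strict_mono r" "P n s"
    then obtain g where "\<And>t. (\<lambda>k. f n (t + \<sigma> (s k))) \<longlonglongrightarrow> g t"
      "\<And>t. (\<lambda>k. g (t - \<sigma> (s k))) \<longlonglongrightarrow> f n t"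
      unfolding P_def by blast
    from this[THEN LIMSEQ_subseq_LIMSEQ[OF _ \<open>strict_mono r\<close>]] show "P n (s \<circ> r)"
      unfolding P_def o_def by blast
  qed
  have "\<exists>g. \<forall>t. (\<lambda>n. f k (t + \<sigma> (diagseq n))) \<longlonglongrightarrow> g t \<and>
      (\<lambda>n. g (t - \<sigma> (diagseq n))) \<longlonglongrightarrow> f k t" for k
  proof -
    obtain g where "\<And>t. (\<lambda>n. f k (t + \<sigma> (diagseq (n + Suc k)))) \<longlonglongrightarrow> g t"
      "\<And>t. (\<lambda>n. g (t - \<sigma> (diagseq (n + Suc k)))) \<longlonglongrightarrow> f k t"
      using P_diag[of k] unfolding P_def o_def add.commute[of "Suc k"] by blast
    from this[THEN LIMSEQ_offset] show ?thesis
      by blast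
  qed
  then obtain g where g: "\<And>k t. (\<lambda>n. f k (t + \<sigma> (diagseq n))) \<longlonglongrightarrow> g k t"
      "\<And>k t. (\<lambda>n. g k (t - \<sigma> (diagseq n))) \<longlonglongrightarrow> f k t"
    by metis
  have "uniformly_Cauchy_on UNIV f"
    using lim by (auto simp: uniformly_convergent_on_def intro!: uniformly_convergent_Cauchy)
  then have "uniformly_Cauchy_on UNIV g"
    unfolding uniformly_Cauchy_on_def
  proof (intro allI impI)
    fix e :: real
    assume f: "\<forall>e>0. \<exists>M. \<forall>x\<in>UNIV. \<forall>m\<ge>M. \<forall>n\<ge>M. dist (f m x) (f n x) < e" and "e > 0"
    then obtain M where M: "\<And>x m n. m \<ge> M \<Longrightarrow> n \<ge> M \<Longrightarrow> dist (f m x) (f n x) < e / 2"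
      by (metis UNIV_I half_gt_zero)
    \<comment> \<open>The bound \<open>e / 2\<close> holds for \<open>f m\<close> and
      \<open>f n\<close> at all translated points; the limit makes it non-strict, and halving
      restores strictness.\<close>
    have "dist (g m x) (g n x) < e" if "m \<ge> M" "n \<ge> M" for m n x
    proof -
      have "dist (g m x) (g n x) \<le> e / 2"
        by (rule tendsto_upperbound[OF tendsto_dist[OF g(1) g(1)]])
          (intro always_eventually allI less_imp_le M that, simp)
      then show ?thesis
        using \<open>e > 0\<close> by simp
    qed
    then show "\<exists>M. \<forall>x\<in>UNIV. \<forall>m\<ge>M. \<forall>n\<ge>M. dist (g m x) (g n x) < e"
      by blast
  qed
  then obtain g' where g': "uniform_limit UNIV g g' sequentially"
    using Cauchy_uniformly_convergent unfolding uniformly_convergent_on_def by blast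
  \<comment> \<open>Sampling at the points \<open>s n\<close> turns uniformity on the line into
    uniformity in the index \<open>n\<close>, the form in which the two limits can be
    exchanged.\<close>
  have uniform_compose: "uniform_limit UNIV (\<lambda>k n. q k (s n)) (\<lambda>n. q' (s n)) sequentially"
    if "uniform_limit UNIV q q' sequentially" for q q' and s :: "nat \<Rightarrow> real"
    using that unfolding uniform_limit_iff by (fast elim: eventually_mono)
  have pointwise: "(\<lambda>k. q k t) \<longlonglongrightarrow> q' t"
    if "uniform_limit UNIV q q' sequentially" for q q' and t :: real
    using that by (rule tendsto_uniform_limitI) simp
  have "(\<lambda>n. l (t + \<sigma> (diagseq n))) \<longlonglongrightarrow> g' t" for t
    by (rule swap_uniform_limit'[OF _ pointwise[OF g'] uniform_compose[OF lim]]) (auto simp: g)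
  moreover have "(\<lambda>n. g' (t - \<sigma> (diagseq n))) \<longlonglongrightarrow> l t" for t
    by (rule swap_uniform_limit'[OF _ pointwise[OF lim] uniform_compose[OF g']]) (auto simp: g)
  ultimately show "\<exists>r g. strict_mono r \<and> (\<forall>t. (\<lambda>n. l (t + \<sigma> (r n))) \<longlonglongrightarrow> g t \<and>
      (\<lambda>n. g (t - \<sigma> (r n))) \<longlonglongrightarrow> l t)"
    using subseq_diagseq by blast
qed

section \<open>The space of asymptotically almost automorphic functions\<close>

lemma C0_diff: "C0 \<phi> \<Longrightarrow> C0 \<psi> \<Longrightarrow> C0 (\<lambda>t. \<phi> t - \<psi> t)"
  using tendsto_diff[of \<phi> 0 at_top \<psi> 0]
  by (auto simp: C0_def tendsto_norm_zero_iff intro: continuous_intros)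

lemma C0_bounded:
  assumes "C0 \<phi>"
  shows "bounded (\<phi> ` {0..})"
proof -
  have "((\<lambda>t. norm (\<phi> t)) \<longlongrightarrow> 0) at_top"
    using assms by (simp add: C0_def)
  then have "\<forall>\<^sub>F t in at_top. norm (\<phi> t) < 1"
    by (rule order_tendstoD(2)) simp
  then obtain T where T: "\<And>t. t \<ge> T \<Longrightarrow> norm (\<phi> t) < 1"
    by (auto simp: eventually_at_top_linorder)
  have "bounded (\<phi> ` {0..T})"
    using assms by (intro compact_imp_bounded compact_continuous_image)
      (auto simp: C0_def elim: continuous_on_subset)
  moreover have "bounded (\<phi> ` {T..})"
    using T by (intro boundedI[of _ 1]) (auto intro: less_imp_le)
  ultimately have "bounded (\<phi> ` {0..T} \<union> \<phi> ` {T..})"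
    by simp
  moreover have "\<phi> ` {0..} \<subseteq> \<phi> ` {0..T} \<union> \<phi> ` {T..}"
    unfolding image_Un[symmetric] by (rule image_mono) auto
  ultimately show ?thesis
    by (rule bounded_subset)
qed

lemma AAA_E:
  assumes "g \<in> AAA"
  obtains f \<phi> where "almost_automorphic f" "C0 \<phi>" "\<And>t. t \<ge> 0 \<Longrightarrow> g t = f t + \<phi> t"
  using assms unfolding AAA_def by blast

lemma AAA_bounded:
  assumes "g \<in> AAA"
  shows "bounded (g ` {0..})"
proof -
  obtain f \<phi> where f: "almost_automorphic f" and \<phi>: "C0 \<phi>" and g: "\<And>t. t \<ge> 0 \<Longrightarrow> g t = f t + \<phi> t"
    using AAA_E[OF assms] by blast
  have "bounded (f ` {0..})"
    using f by (auto simp: almost_automorphic_def elim: bounded_subset)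
  then have "bounded ((\<lambda>t. f t + \<phi> t) ` {0..})"
    using C0_bounded[OF \<phi>] by (rule bounded_plus_comp)
  then show ?thesis
    using g by (metis (no_types, lifting) atLeast_iff image_cong)
qed

lemma AAA_continuous: "g \<in> AAA \<Longrightarrow> continuous_on {0..} g"
  by (simp add: AAA_def)

lemma AAA_eqI:
  "f \<in> AAA \<Longrightarrow> g \<in> AAA \<Longrightarrow> (\<And>t. t \<ge> 0 \<Longrightarrow> f t = g t) \<Longrightarrow> f = g"
  by (rule extensionalityI[of _ "{0..}"]) (auto simp: AAA_def)

lemma zero_fun_AAA: "zero_fun \<in> AAA"
proof -
  have "continuous_on {0..} (zero_fun :: real \<Rightarrow> 'a)"
    by (rule continuous_on_eq[where f = "\<lambda>_. 0"]) (auto simp: zero_fun_def)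
  then show ?thesis
    using almost_automorphic_const[of "0::'a"]
    by (auto simp: AAA_def zero_fun_def C0_def intro!: exI[of _ "\<lambda>_. 0::'a"])
qed

text \<open>Supplies a point of \<open>Delta0\<close> at distance exactly \<open>\<rho>\<close> from
  its centre, from which the sign of \<open>L_h\<close> is read off.\<close>

lemma AAA_add_const:
  assumes "g \<in> AAA"
  shows "(\<lambda>t\<in>{0..}. g t + c) \<in> AAA"
proof -
  obtain f \<phi> where f: "almost_automorphic f" and \<phi>: "C0 \<phi>" and g: "\<And>t. t \<ge> 0 \<Longrightarrow> g t = f t + \<phi> t"
    using AAA_E[OF assms] by blast
  have "continuous_on {0..} (\<lambda>t\<in>{0..}. g t + c)"
    by (rule continuous_on_eq[where f = "\<lambda>t. g t + c"])
      (auto intro: continuous_intros AAA_continuous[OF assms])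
  moreover have "almost_automorphic (\<lambda>t. f t + c)"
    using almost_automorphic_diff[OF f almost_automorphic_const, of "- c"] by simp
  ultimately show ?thesis
    using \<phi> g unfolding AAA_def
    by (intro CollectI conjI exI[of _ "\<lambda>t. f t + c"] exI[of _ \<phi>]) auto
qed

text \<open>Differences of the almost automorphic parts are bounded by differences of the
  \<open>g n\<close> on the half-line, so these parts converge uniformly on the whole line. The
  remainders then converge uniformly too, and each component class is closed under such
  limits.\<close>

lemma AAA_uniform_limit:
  fixes g :: "nat \<Rightarrow> real \<Rightarrow> 'a::banach"
  assumes g: "\<And>n. g n \<in> AAA" and lim: "uniform_limit {0..} g l sequentially"
    and l: "l \<in> extensional {0..}"
  shows "l \<in> AAA"
proof -
  have "\<forall>n. \<exists>f \<phi>. almost_automorphic f \<and> C0 \<phi> \<and> (\<forall>t\<ge>0. g n t = f t + \<phi> t)"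
    using g unfolding AAA_def by blast
  then obtain f \<phi> where f: "\<And>n. almost_automorphic (f n)" and \<phi>: "\<And>n. C0 (\<phi> n)"
    and fg: "\<And>n t. t \<ge> 0 \<Longrightarrow> g n t = f n t + \<phi> n t"
    by metis
  have "uniformly_Cauchy_on {0..} g"
    using lim by (auto simp: uniformly_convergent_on_def intro!: uniformly_convergent_Cauchy)
  then have "uniformly_Cauchy_on UNIV f"
    unfolding uniformly_Cauchy_on_def
  proof (intro allI impI)
    fix e :: real
    assume *: "\<forall>e>0. \<exists>M. \<forall>x\<in>{0..}. \<forall>m\<ge>M. \<forall>n\<ge>M. dist (g m x) (g n x) < e" and "e > 0"
    then obtain M where M: "\<And>x m n. x \<ge> 0 \<Longrightarrow> m \<ge> M \<Longrightarrow> n \<ge> M \<Longrightarrow> dist (g m x) (g n x) < e / 2"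
      by (metis atLeast_iff half_gt_zero)
    have "dist (f m x) (f n x) < e" if mn: "m \<ge> M" "n \<ge> M" for m n x
    proof -
      have "norm (f m x - f n x) \<le> e / 2"
      proof (rule almost_automorphic_norm_le[OF almost_automorphic_diff[OF f f] C0_diff[OF \<phi> \<phi>]])
        fix t :: real
        assume t: "t \<ge> 0"
        then have "f m t - f n t + (\<phi> m t - \<phi> n t) = g m t - g n t"
          by (simp add: fg)
        then show "norm (f m t - f n t + (\<phi> m t - \<phi> n t)) \<le> e / 2"
          using M[OF t mn] by (simp add: dist_norm)
      qed
      then show ?thesis
        using \<open>e > 0\<close> by (simp add: dist_norm)
    qed
    then show "\<exists>M. \<forall>x\<in>UNIV. \<forall>m\<ge>M. \<forall>n\<ge>M. dist (f m x) (f n x) < e"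
      by blast
  qed
  then obtain f' where f': "uniform_limit UNIV f f' sequentially"
    using Cauchy_uniformly_convergent unfolding uniformly_convergent_on_def by blast
  define \<phi>' where "\<phi>' t = l t - f' t" for t
  have "uniform_limit {0..} (\<lambda>n t. g n t - f n t) \<phi>' sequentially"
    unfolding \<phi>'_def
    by (intro uniform_limit_intros lim uniform_limit_on_subset[OF f']) simp
  then have \<phi>': "uniform_limit {0..} \<phi> \<phi>' sequentially"
    by (rule uniform_limit_cong'[THEN iffD1, rotated 2]) (auto simp: fg)
  have "C0 \<phi>'"
    unfolding C0_def tendsto_norm_zero_iff
  proof
    show "continuous_on {0..} \<phi>'"
      using \<phi> \<phi>' by (intro uniform_limit_theorem[of _ \<phi>]) (auto simp: C0_def)
    \<comment> \<open>Exchange of limits: each \<open>\<phi> n\<close> tends to 0 at infinity, and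
      the convergence in \<open>n\<close> is uniform on the half-line.\<close>
    show "(\<phi>' \<longlongrightarrow> 0) at_top"
      using \<phi> by (intro swap_uniform_limit'[OF _ tendsto_const \<phi>'])
        (auto simp: C0_def tendsto_norm_zero_iff eventually_ge_at_top)
  qed
  moreover have "almost_automorphic f'"
    using f f' by (rule almost_automorphic_uniform_limit)
  moreover have "continuous_on {0..} l"
    using AAA_continuous[OF g] by (intro uniform_limit_theorem[OF _ lim]) auto
  ultimately show ?thesis
    using l unfolding AAA_def
    by (intro CollectI conjI exI[of _ f'] exI[of _ \<phi>']) (auto simp: \<phi>'_def)
qed

section \<open>The supremum distance and completeness of \<open>Delta0\<close>\<close>

lemma norm_diff_le_sup_dist:
  assumes "f \<in> AAA" "g \<in> AAA" "t \<ge> 0"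
  shows "norm (f t - g t) \<le> sup_dist f g"
proof -
  have "bounded ((\<lambda>t. f t - g t) ` {0..})"
    using assms by (intro bounded_minus_comp AAA_bounded)
  \<comment> \<open>A real-valued \<open>SUP\<close> is an upper bound only for a set that is
    bounded above.\<close>
  then have "bdd_above ((\<lambda>t. norm (f t - g t)) ` {0..})"
    by (force simp: bounded_iff bdd_above_def)
  then show ?thesis
    unfolding sup_dist_def using assms by (intro cSUP_upper) auto
qed

lemma sup_dist_nonneg: "f \<in> AAA \<Longrightarrow> g \<in> AAA \<Longrightarrow> 0 \<le> sup_dist f g"
  using norm_diff_le_sup_dist[of f g 0] norm_ge_zero by (metis order_refl order_trans)

lemma sup_dist_leI:
  "(\<And>t. t \<ge> 0 \<Longrightarrow> norm (f t - g t) \<le> c) \<Longrightarrow> sup_dist f g \<le> c"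
  unfolding sup_dist_def by (intro cSUP_least) auto

lemma sup_dist_triangle:
  assumes "f \<in> AAA" "g \<in> AAA" "h \<in> AAA"
  shows "sup_dist f h \<le> sup_dist f g + sup_dist g h"
proof (rule sup_dist_leI)
  fix t :: real
  assume "t \<ge> 0"
  then show "norm (f t - h t) \<le> sup_dist f g + sup_dist g h"
    using norm_diff_le_sup_dist[of f g t] norm_diff_le_sup_dist[of g h t] assms
      norm_triangle_ineq[of "f t - g t" "g t - h t"] by simp
qed

text \<open>Functions in \<^const>\<open>AAA\<close> are embedded into the complete space of bounded continuous
  functions on the whole line by extending them with the value at 0.\<close>

definition extend_left :: "(real \<Rightarrow> 'a::banach) \<Rightarrow> real \<Rightarrow>\<^sub>C 'a" where
  "extend_left g = Bcontfun (\<lambda>t. g (max t 0))"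

lemma extend_left_apply:
  assumes "g \<in> AAA"
  shows "apply_bcontfun (extend_left g) t = g (max t 0)"
proof -
  have "continuous_on UNIV (\<lambda>t. g (max t 0))"
    by (rule continuous_on_compose2[OF AAA_continuous[OF assms]]) (auto intro: continuous_intros)
  moreover have "bounded (range (\<lambda>t. g (max t 0)))"
    by (rule bounded_subset[OF AAA_bounded[OF assms]]) auto
  ultimately show ?thesis
    unfolding extend_left_def by (subst Bcontfun_inverse) (auto simp: bcontfun_def)
qed

lemma dist_extend_left:
  assumes "f \<in> AAA" "g \<in> AAA"
  shows "dist (extend_left f) (extend_left g) = sup_dist f g"
proof (rule antisym)
  show "dist (extend_left f) (extend_left g) \<le> sup_dist f g"
    using assms
    by (intro dist_bound) (auto simp: extend_left_apply dist_norm intro: norm_diff_le_sup_dist)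
  show "sup_dist f g \<le> dist (extend_left f) (extend_left g)"
  proof (rule sup_dist_leI)
    fix t :: real
    assume "t \<ge> 0"
    then show "norm (f t - g t) \<le> dist (extend_left f) (extend_left g)"
      using dist_bounded[of "extend_left f" t "extend_left g"] assms
      by (simp add: extend_left_apply dist_norm)
  qed
qed

text \<open>The image is closed in a complete space: a limit restricts to a uniform limit on the
  half-line, which stays in \<open>AAA\<close>, and the distance bound is preserved in the
  limit.\<close>

lemma complete_extend_left_Delta0:
  fixes y0 :: "real \<Rightarrow> 'a::banach"
  assumes y0: "y0 \<in> AAA"
  shows "complete (extend_left ` Delta0 y0 \<rho>)"
  unfolding complete_eq_closed closed_sequential_limits
proof (intro allI impI, elim conjE)
  fix w :: "nat \<Rightarrow> real \<Rightarrow>\<^sub>C 'a" and l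
  assume "\<forall>n. w n \<in> extend_left ` Delta0 y0 \<rho>" and lim: "w \<longlonglongrightarrow> l"
  then obtain g where g: "\<And>n. g n \<in> Delta0 y0 \<rho>" and w: "\<And>n. w n = extend_left (g n)"
    unfolding image_iff by metis
  have gA: "g n \<in> AAA" for n
    using g by (simp add: Delta0_def)
  define l' where "l' = (\<lambda>t\<in>{0..}. l t)"
  have ul: "uniform_limit UNIV (\<lambda>n t. w n t) l sequentially"
    unfolding uniform_limit_iff
  proof (intro allI impI)
    fix e :: real
    assume "e > 0"
    with lim have "\<forall>\<^sub>F n in sequentially. dist (w n) l < e"
      by (rule tendstoD)
    then show "\<forall>\<^sub>F n in sequentially. \<forall>t\<in>UNIV. dist (w n t) (l t) < e"
      by eventually_elim (meson dist_bounded le_less_trans)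
  qed
  have pt: "(\<lambda>n. w n t) \<longlonglongrightarrow> l t" for t
    using ul by (rule tendsto_uniform_limitI) simp
  have "uniform_limit {0..} (\<lambda>n t. w n t) l sequentially"
    using ul by (rule uniform_limit_on_subset) simp
  then have "uniform_limit {0..} g l' sequentially"
    by (rule uniform_limit_cong'[THEN iffD1, rotated 2])
      (auto simp: w extend_left_apply gA l'_def)
  then have l': "l' \<in> AAA"
    by (rule AAA_uniform_limit[OF gA]) (simp add: l'_def)
  \<comment> \<open>Every \<open>w n\<close> is constant to the left of 0, so the limit is too and
    is therefore the extension of its own restriction.\<close>
  have "l t = l (max t 0)" for t
  proof (rule LIMSEQ_unique[OF pt])
    show "(\<lambda>n. w n t) \<longlonglongrightarrow> l (max t 0)"
      using pt[of "max t 0"] by (simp add: w extend_left_apply gA)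
  qed
  then have l: "l = extend_left l'"
    using l' by (intro bcontfun_eqI) (simp add: extend_left_apply l'_def)
  have "dist (w n) (extend_left y0) \<le> \<rho>" for n
    using g y0 by (simp add: w Delta0_def dist_extend_left)
  then have "dist l (extend_left y0) \<le> \<rho>"
    by (intro tendsto_upperbound[OF tendsto_dist[OF lim tendsto_const]]) auto
  then show "l \<in> extend_left ` Delta0 y0 \<rho>"
    using l l' y0 by (simp add: Delta0_def dist_extend_left)
qed

text \<open>Banach's theorem is applied to the conjugate of \<open>\<Phi>\<close> under
  \<open>extend_left\<close>, which is isometric on \<open>AAA\<close>; its injectivity there brings
  the fixed point and its uniqueness back.\<close>

lemma Delta0_fixed_point:
  fixes y0 :: "real \<Rightarrow> 'a::banach"
  assumes y0: "y0 \<in> AAA" and "0 \<le> \<rho>" and c: "0 \<le> c" "c < 1"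
    and \<Phi>: "\<Phi> \<in> Delta0 y0 \<rho> \<rightarrow> Delta0 y0 \<rho>"
    and contr: "\<And>y z. y \<in> Delta0 y0 \<rho> \<Longrightarrow> z \<in> Delta0 y0 \<rho> \<Longrightarrow>
      sup_dist (\<Phi> y) (\<Phi> z) \<le> c * sup_dist y z"
  shows "\<exists>!y. y \<in> Delta0 y0 \<rho> \<and> \<Phi> y = y"
proof -
  let ?D = "Delta0 y0 \<rho>"
  have AAA: "y \<in> AAA" if "y \<in> ?D" for y
    using that by (simp add: Delta0_def)
  have inj: "inj_on extend_left ?D"
  proof (rule inj_onI)
    fix y z
    assume "y \<in> ?D" "z \<in> ?D" "extend_left y = extend_left z"
    then show "y = z"
      using AAA extend_left_apply[of y] extend_left_apply[of z]
      by (intro AAA_eqI) (simp, simp, metis max.absorb1)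
  qed
  define \<Psi> where "\<Psi> w = extend_left (\<Phi> (inv_into ?D extend_left w))" for w
  have \<Psi>: "\<Psi> (extend_left y) = extend_left (\<Phi> y)" if "y \<in> ?D" for y
    using that by (simp add: \<Psi>_def inv_into_f_f[OF inj])
  have "y0 \<in> ?D"
    using y0 \<open>0 \<le> \<rho>\<close> by (simp add: Delta0_def sup_dist_def)
  then have "\<exists>!w. w \<in> extend_left ` ?D \<and> \<Psi> w = w"
    using c contr funcset_mem[OF \<Phi>]
    by (intro Banach_fix[OF complete_extend_left_Delta0[OF y0]])
      (auto simp: \<Psi> dist_extend_left AAA)
  then obtain w where w: "w \<in> extend_left ` ?D" "\<Psi> w = w"
    and unique: "\<And>w'. w' \<in> extend_left ` ?D \<Longrightarrow> \<Psi> w' = w' \<Longrightarrow> w' = w"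
    by blast
  from w(1) obtain y where y: "y \<in> ?D" and wy: "w = extend_left y"
    by blast
  show ?thesis
  proof (intro ex1I[of _ y] conjI y)
    have "extend_left (\<Phi> y) = extend_left y"
      using w(2) \<Psi>[OF y] by (simp add: wy)
    then show "\<Phi> y = y"
      using funcset_mem[OF \<Phi> y] y by (rule inj_onD[OF inj])
  next
    fix z
    assume z: "z \<in> ?D \<and> \<Phi> z = z"
    then have "extend_left z = extend_left y"
      using unique[of "extend_left z"] \<Psi>[of z] by (simp add: wy)
    then show "z = y"
      using z y by (intro inj_onD[OF inj]) auto
  qed
qed

section \<open>Integral estimates\<close>

text \<open>At \<open>x = 0\<close> the quotient in \<open>op_ennorm\<close> is 0 by the convention
  for division by zero and says nothing about \<open>T 0\<close>, hence the second
  assumption.\<close>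

lemma op_ennorm_bound:
  assumes "op_ennorm T \<noteq> \<infinity>" "T 0 = 0"
  shows "norm (T x) \<le> enn2real (op_ennorm T) * norm x"
proof (cases "x = 0")
  case False
  have "ennreal (norm (T x) / norm x) \<le> op_ennorm T"
    unfolding op_ennorm_def by (rule SUP_upper) simp
  then have "norm (T x) / norm x \<le> enn2real (op_ennorm T)"
    using assms(1) by (metis divide_nonneg_nonneg enn2real_ennreal enn2real_mono infinity_ennreal_def
        less_top norm_ge_zero)
  then show ?thesis
    using False by (simp add: field_simps)
qed (simp add: assms)

text \<open>A finite integral lets the operator norm be infinite only on a null set. Off that set
  the integrand is dominated by the real-valued norm times \<open>d\<close>.\<close>

lemma norm_integral_le_op_ennorm:
  fixes T :: "real \<Rightarrow> 'a::banach \<Rightarrow> 'b::banach"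
  assumes meas: "(\<lambda>\<tau>. op_ennorm (T \<tau>)) \<in> borel_measurable (lebesgue_on {a..b})"
    and fin: "(\<integral>\<^sup>+ \<tau>. op_ennorm (T \<tau>) \<partial>lebesgue_on {a..b}) < \<infinity>"
    and T0: "\<And>\<tau>. \<tau> \<in> {a..b} \<Longrightarrow> T \<tau> 0 = 0"
    and int: "(\<lambda>\<tau>. T \<tau> (u \<tau>)) integrable_on {a..b}"
    and d: "0 \<le> d" "\<And>\<tau>. \<tau> \<in> {a..b} \<Longrightarrow> norm (u \<tau>) \<le> d"
  shows "norm (integral {a..b} (\<lambda>\<tau>. T \<tau> (u \<tau>)))
    \<le> enn2real (\<integral>\<^sup>+ \<tau>. op_ennorm (T \<tau>) \<partial>lebesgue_on {a..b}) * d"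
proof -
  let ?L = "lebesgue_on {a..b}"
  define b' where "b' \<tau> = enn2real (op_ennorm (T \<tau>))" for \<tau>
  define N where "N = {\<tau>\<in>{a..b}. op_ennorm (T \<tau>) = \<infinity>}"
  have "emeasure ?L ((\<lambda>\<tau>. op_ennorm (T \<tau>)) -` {\<infinity>} \<inter> space ?L) = 0"
    using fin by (intro nn_integral_PInf[OF meas]) auto
  moreover have "(\<lambda>\<tau>. op_ennorm (T \<tau>)) -` {\<infinity>} \<inter> space ?L = N"
    by (auto simp: N_def)
  moreover have "(\<lambda>\<tau>. op_ennorm (T \<tau>)) -` {\<infinity>} \<inter> space ?L \<in> sets ?L"
    using meas by (rule measurable_sets) simp
  ultimately have "N \<in> null_sets ?L"
    by (auto simp: null_sets_def)
  then have N: "negligible N"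
    by (simp add: null_sets_restrict_space negligible_iff_null_sets)
  have b'_meas: "b' \<in> borel_measurable ?L"
    unfolding b'_def using meas by measurable
  \<comment> \<open>\<open>enn2real\<close> sends \<infinity> to 0, so passing to real values can
    only lower the integral.\<close>
  have le: "(\<integral>\<^sup>+ \<tau>. ennreal (b' \<tau>) \<partial>?L) \<le> (\<integral>\<^sup>+ \<tau>. op_ennorm (T \<tau>) \<partial>?L)"
    by (intro nn_integral_mono) (simp add: b'_def ennreal_enn2real_if)
  have b'_int: "integrable ?L b'"
    using le fin by (intro integrableI_nonneg b'_meas) (auto simp: b'_def)
  have "integral\<^sup>L ?L b' = enn2real (\<integral>\<^sup>+ \<tau>. ennreal (b' \<tau>) \<partial>?L)"
    by (intro integral_eq_nn_integral b'_meas) (auto simp: b'_def)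
  also have "\<dots> \<le> enn2real (\<integral>\<^sup>+ \<tau>. op_ennorm (T \<tau>) \<partial>?L)"
    using le fin by (intro enn2real_mono) auto
  finally have b'_le: "integral {a..b} b' \<le> enn2real (\<integral>\<^sup>+ \<tau>. op_ennorm (T \<tau>) \<partial>?L)"
    using lebesgue_integral_eq_integral[OF b'_int] by simp
  \<comment> \<open>On \<open>N\<close> the real-valued bound \<open>b'\<close> is 0 and bounds
    nothing, so the integrand is set to 0 there without changing its integral.\<close>
  define v where "v \<tau> = (if \<tau> \<in> N then 0 else T \<tau> (u \<tau>))" for \<tau>
  have "integral {a..b} (\<lambda>\<tau>. T \<tau> (u \<tau>)) = integral {a..b} v"
    by (rule integral_spike[OF N]) (auto simp: v_def)
  moreover have "norm (integral {a..b} v) \<le> integral {a..b} (\<lambda>\<tau>. b' \<tau> * d)"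
  proof (rule integral_norm_bound_integral)
    show "v integrable_on {a..b}"
      by (rule integrable_spike[OF int N]) (auto simp: v_def)
    show "(\<lambda>\<tau>. b' \<tau> * d) integrable_on {a..b}"
      using integrable_on_lebesgue_on[OF b'_int] by (intro integrable_on_mult_left) simp
    fix \<tau>
    assume \<tau>: "\<tau> \<in> {a..b}"
    have "norm (T \<tau> (u \<tau>)) \<le> b' \<tau> * d" if "\<tau> \<notin> N"
    proof -
      have "norm (T \<tau> (u \<tau>)) \<le> b' \<tau> * norm (u \<tau>)"
        unfolding b'_def using that \<tau> T0 by (intro op_ennorm_bound) (auto simp: N_def)
      also have "\<dots> \<le> b' \<tau> * d"
        using d \<tau> by (intro mult_left_mono) (auto simp: b'_def)
      finally show ?thesis .
    qed
    then show "norm (v \<tau>) \<le> b' \<tau> * d"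
      using d(1) by (simp add: v_def b'_def)
  qed
  ultimately show ?thesis
    using mult_right_mono[OF b'_le d(1)] by simp
qed

lemma has_integral_exp_convolution:
  fixes \<delta> t :: real
  assumes "\<delta> \<noteq> 0" "0 \<le> t"
  shows "((\<lambda>s. exp (- \<delta> * (t - s))) has_integral (1 - exp (- \<delta> * t)) / \<delta>) {0..t}"
proof -
  have "((\<lambda>s. exp (- \<delta> * (t - s))) has_integral
      exp (- \<delta> * (t - t)) / \<delta> - exp (- \<delta> * (t - 0)) / \<delta>) {0..t}"
  proof (rule fundamental_theorem_of_calculus[OF assms(2)])
    fix s
    show "((\<lambda>s. exp (- \<delta> * (t - s)) / \<delta>) has_vector_derivative exp (- \<delta> * (t - s)))
        (at s within {0..t})"
      using assms(1) unfolding has_real_derivative_iff_has_vector_derivative[symmetric]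
      by (auto intro!: derivative_eq_intros)
  qed
  then show ?thesis
    by (simp add: diff_divide_distrib)
qed

lemma linear_operator_diff:
  assumes "linear_operator UNIV T"
  shows "T (x - y) = T x - T y"
proof -
  have "T (x - y + y) = T (x - y) + T y"
    using assms unfolding linear_operator_def by blast
  then show ?thesis
    by simp
qed

section \<open>The operator \<open>Gamma_op\<close> as a contraction of
  \<open>Delta0\<close>\<close>

theorem theorem5p7:
  fixes D :: "real \<Rightarrow> 'a::complex_banach set"
    and A :: "real \<Rightarrow> 'a \<Rightarrow> 'a"
    and U B :: "real \<Rightarrow> real \<Rightarrow> 'a \<Rightarrow> 'a"
    and F :: "real \<Rightarrow> 'a \<Rightarrow> 'a \<Rightarrow> 'a"
    and h :: "(real \<Rightarrow> 'a) \<Rightarrow> 'a"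
    and u0 :: 'a
    and y0 :: "real \<Rightarrow> 'a"
    and M \<delta> L_F L_h \<rho> \<theta> \<xi>0 :: real
  assumes AT: "acquistapace_terreni D A"
    and U: "governs U D A"
    and bi_aa: "bi_almost_automorphic_halfline U"
    and M: "M > 0" and \<delta>: "\<delta> > 0"
    and exp_stable: "\<And>t s. 0 \<le> s \<Longrightarrow> s \<le> t \<Longrightarrow> onorm (U t s) \<le> M * exp (- \<delta> * (t - s))"
    and B_linear: "\<And>t s. 0 \<le> s \<Longrightarrow> s \<le> t \<Longrightarrow> linear_operator UNIV (B t s)"
    and B_measurable: "\<And>s. 0 \<le> s \<Longrightarrow>
      (\<lambda>\<tau>. op_ennorm (B s \<tau>)) \<in> borel_measurable (lebesgue_on {0..s})"
    and C_B_finite: "C_B B < \<infinity>"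
    and F: "AAA_param (\<lambda>t (x, z). F t x z)"
    and F_Lipschitz: "\<And>t x z x' z'. 0 \<le> t \<Longrightarrow>
      norm (F t x z - F t x' z') \<le> L_F * (norm (x - x') + norm (z - z'))"
    and \<rho>: "\<rho> > 0"
    and y0: "y0 = y_zero U F h u0"
    and h_Lipschitz: "\<And>x y. x \<in> Delta0 y0 \<rho> \<Longrightarrow> y \<in> Delta0 y0 \<rho> \<Longrightarrow>
      norm (h x - h y) \<le> L_h * sup_dist x y"
    and Gamma_defined: "\<And>y. y \<in> AAA \<Longrightarrow> integrals_exist U B F y"
    and Gamma: "Gamma_op U B F h u0 \<in> AAA \<rightarrow> AAA"
    and \<xi>0: "\<xi>0 = M * L_h + M / \<delta> * L_F * (1 + enn2real (C_B B))"
    and \<theta>: "\<theta> = inverse (1 - \<xi>0) * sup_dist (Gamma_op U B F h u0 y0) y0"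
    and \<theta>_bounds: "0 < \<theta>" "\<theta> \<le> \<rho>"
  shows "\<exists>!y. y \<in> AAA \<and> mild_solution U B F h u0 y \<and> sup_dist y y0 \<le> \<rho>"
proof -
  let ?\<Gamma> = "Gamma_op U B F h u0"
  let ?B = "volterra_op B"
  have U_linear: "bounded_linear (U t s)" if "0 \<le> s" "s \<le> t" for t s
    using U that unfolding governs_def evolution_family_def by blast
  have U_bound: "norm (U t s x) \<le> M * exp (- \<delta> * (t - s)) * norm x" if "0 \<le> s" "s \<le> t" for t s x
    using onorm[OF U_linear[OF that], of x] mult_right_mono[OF exp_stable[OF that] norm_ge_zero, of x]
    by linarith
  have B_zero: "B t s 0 = 0" if "0 \<le> s" "s \<le> t" for t s
    using linear_operator_diff[OF B_linear[OF that], of 0 0] by simp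

  have "?B zero_fun s = 0" if "0 \<le> s" for s
    unfolding volterra_op_def zero_fun_def using that
    by (intro integral_unique has_integral_is_0) (auto simp: B_zero)
  then have "y0 = ?\<Gamma> zero_fun"
    unfolding y0 y_zero_def Gamma_op_def
    by (intro ext) (auto simp: restrict_def zero_fun_def intro!: Henstock_Kurzweil_Integration.integral_cong)
  then have y0_AAA: "y0 \<in> AAA"
    using Gamma zero_fun_AAA by auto
  then have \<Gamma>y0_AAA: "?\<Gamma> y0 \<in> AAA"
    using Gamma by blast
  \<comment> \<open>A positive product with a nonnegative second factor needs
    \<open>inverse (1 - \<xi>0)\<close> positive; \<open>inverse 0 = 0\<close> rules out the value
    1.\<close>
  have \<xi>0_less: "\<xi>0 < 1"
    using \<theta>_bounds(1) sup_dist_nonneg[OF \<Gamma>y0_AAA y0_AAA] unfolding \<theta>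
    by (auto simp: zero_less_mult_iff)
  \<comment> \<open>In the zero space the Lipschitz inequalities would not determine the signs of
    \<open>L_F\<close> and \<open>L_h\<close>. Positivity of \<open>\<theta>\<close> provides a
    nonzero vector.\<close>
  obtain t where "?\<Gamma> y0 t - y0 t \<noteq> 0"
    using \<theta>_bounds(1) unfolding \<theta> sup_dist_def by fastforce
  then obtain v :: 'a where v: "v \<noteq> 0"
    by blast
  have L_F: "0 \<le> L_F"
    using order_trans[OF norm_ge_zero F_Lipschitz[of 0 v 0 0 0]] v
    by (simp add: zero_le_mult_iff)
  have L_h: "0 \<le> L_h"
  proof -
    \<comment> \<open>A vector of norm \<open>\<rho>\<close>: the shift of \<open>y0\<close> by
      \<open>w\<close> still lies in \<open>Delta0\<close>, and the Lipschitz inequality between the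
      two gives \<open>0 \<le> L_h * \<rho>\<close>.\<close>
    define w where "w = (\<rho> / norm v) *\<^sub>R v"
    have "norm w = \<rho>"
      using v \<rho> by (simp add: w_def)
    define y where "y = (\<lambda>t\<in>{0..}. y0 t + w)"
    have y: "sup_dist y y0 = \<rho>"
      using \<open>norm w = \<rho>\<close> by (simp add: sup_dist_def y_def)
    then have "y \<in> Delta0 y0 \<rho>" "y0 \<in> Delta0 y0 \<rho>"
      using AAA_add_const[OF y0_AAA, of w] y0_AAA \<rho>
      by (auto simp: Delta0_def y_def sup_dist_def)
    then have "0 \<le> L_h * \<rho>"
      using h_Lipschitz[of y y0] y norm_ge_zero by (metis order_trans)
    then show ?thesis
      using \<rho> by (simp add: zero_le_mult_iff)
  qed

  \<comment> \<open>Lipschitz estimates for \<open>volterra_op\<close> and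
    \<open>Gamma_op\<close>\<close>
  have B_bound: "norm (?B y t - ?B z t) \<le> enn2real (C_B B) * sup_dist y z"
    if yz: "y \<in> AAA" "z \<in> AAA" and t: "0 \<le> t" for y z t
  proof -
    let ?I = "\<integral>\<^sup>+ \<tau>. op_ennorm (B t \<tau>) \<partial>lebesgue_on {0..t}"
    have I: "?I \<le> C_B B"
      unfolding C_B_def using t by (intro SUP_upper) simp
    have int: "(\<lambda>s. B t s (y s)) integrable_on {0..t}" "(\<lambda>s. B t s (z s)) integrable_on {0..t}"
      using Gamma_defined yz t by (auto simp: integrals_exist_def)
    have diff: "B t s (y s) - B t s (z s) = B t s (y s - z s)" if "s \<in> {0..t}" for s
      using that linear_operator_diff[OF B_linear] by simp
    have "?B y t - ?B z t = integral {0..t} (\<lambda>s. B t s (y s) - B t s (z s))"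
      unfolding volterra_op_def using int by (rule integral_diff[symmetric])
    also have "\<dots> = integral {0..t} (\<lambda>s. B t s (y s - z s))"
      using diff by (rule Henstock_Kurzweil_Integration.integral_cong)
    also have "norm \<dots> \<le> enn2real ?I * sup_dist y z"
    proof (rule norm_integral_le_op_ennorm)
      show "?I < \<infinity>"
        using I C_B_finite by (rule le_less_trans)
      show "(\<lambda>s. B t s (y s - z s)) integrable_on {0..t}"
        using integrable_diff[OF int] diff by (rule integrable_eq)
    qed (use t yz in \<open>auto intro: B_measurable B_zero sup_dist_nonneg norm_diff_le_sup_dist\<close>)
    also have "\<dots> \<le> enn2real (C_B B) * sup_dist y z"
      using I C_B_finite yz by (intro mult_right_mono enn2real_mono sup_dist_nonneg) auto
    finally show ?thesis .
  qed

  have contraction: "sup_dist (?\<Gamma> y) (?\<Gamma> z) \<le> \<xi>0 * sup_dist y z"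
    if "y \<in> Delta0 y0 \<rho>" "z \<in> Delta0 y0 \<rho>" for y z
  proof (rule sup_dist_leI)
    fix t :: real
    assume t: "0 \<le> t"
    let ?d = "sup_dist y z"
    let ?G = "\<lambda>y s. F s (y s) (?B y s)"
    \<comment> \<open>\<open>K\<close> is the Lipschitz bound for the nonlinearity, uniform in time:
      \<open>norm_diff_le_sup_dist\<close> contributes the 1 and \<open>B_bound\<close> the term
      with \<open>C_B\<close>.\<close>
    define K where "K = L_F * (1 + enn2real (C_B B)) * ?d"
    have yz: "y \<in> AAA" "z \<in> AAA"
      using that by (auto simp: Delta0_def)
    have K: "0 \<le> K"
      unfolding K_def using L_F sup_dist_nonneg[OF yz] by simp
    have int: "(\<lambda>s. U t s (?G y s)) integrable_on {0..t}" "(\<lambda>s. U t s (?G z s)) integrable_on {0..t}"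
      using Gamma_defined yz t by (auto simp: integrals_exist_def)
    have "norm (U t 0 (u0 + h y) - U t 0 (u0 + h z)) = norm (U t 0 (h y - h z))"
      using linear_diff[OF bounded_linear.linear, OF U_linear, of 0 t "u0 + h y" "u0 + h z"] t by simp
    also have "\<dots> \<le> M * exp (- \<delta> * (t - 0)) * norm (h y - h z)"
      using t by (intro U_bound) auto
    \<comment> \<open>The exponential is at most 1; this gives the summand \<open>M * L_h\<close> of
      \<open>\<xi>0\<close>.\<close>
    also have "\<dots> \<le> M * 1 * (L_h * ?d)"
      using M \<delta> t h_Lipschitz[OF that] by (intro mult_mono mult_left_mono) auto
    finally have init: "norm (U t 0 (u0 + h y) - U t 0 (u0 + h z)) \<le> M * L_h * ?d"
      by simp
    have "norm (integral {0..t} (\<lambda>s. U t s (?G y s) - U t s (?G z s)))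
        \<le> integral {0..t} (\<lambda>s. exp (- \<delta> * (t - s)) * (M * K))"
    proof (rule integral_norm_bound_integral)
      show "(\<lambda>s. U t s (?G y s) - U t s (?G z s)) integrable_on {0..t}"
        using int by (rule integrable_diff)
      show "(\<lambda>s. exp (- \<delta> * (t - s)) * (M * K)) integrable_on {0..t}"
        using has_integral_exp_convolution[of \<delta> t] \<delta> t
        by (intro integrable_on_mult_left) (auto intro: has_integral_integrable)
      fix s
      assume "s \<in> {0..t}"
      then have s: "0 \<le> s" "s \<le> t"
        by auto
      have "norm (?G y s - ?G z s) \<le> L_F * (norm (y s - z s) + norm (?B y s - ?B z s))"
        using s by (intro F_Lipschitz)
      also have "\<dots> \<le> L_F * (?d + enn2real (C_B B) * ?d)"
        using s L_F yz by (intro mult_left_mono add_mono norm_diff_le_sup_dist B_bound)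
      finally have G: "norm (?G y s - ?G z s) \<le> K"
        by (simp add: K_def algebra_simps)
      have "norm (U t s (?G y s) - U t s (?G z s)) = norm (U t s (?G y s - ?G z s))"
        using linear_diff[OF bounded_linear.linear, OF U_linear[OF s]] by simp
      also have "\<dots> \<le> M * exp (- \<delta> * (t - s)) * norm (?G y s - ?G z s)"
        using s by (rule U_bound)
      also have "\<dots> \<le> M * exp (- \<delta> * (t - s)) * K"
        using M G by (intro mult_left_mono) auto
      finally show "norm (U t s (?G y s) - U t s (?G z s)) \<le> exp (- \<delta> * (t - s)) * (M * K)"
        by (simp add: mult_ac)
    qed
    also have "\<dots> = (1 - exp (- \<delta> * t)) / \<delta> * (M * K)"
      using has_integral_mult_left[OF has_integral_exp_convolution[of \<delta> t], of "M * K"] \<delta> t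
      by (intro integral_unique) simp
    \<comment> \<open>Dropping the negative exponential makes the bound independent of
      \<open>t\<close> and gives the summand of \<open>\<xi>0\<close> with the factor
      \<open>M / \<delta>\<close>.\<close>
    also have "\<dots> \<le> 1 / \<delta> * (M * K)"
      using M \<delta> K by (intro mult_right_mono divide_right_mono) auto
    finally have rest: "norm (integral {0..t} (\<lambda>s. U t s (?G y s)) - integral {0..t} (\<lambda>s. U t s (?G z s)))
        \<le> M / \<delta> * K"
      using int by (simp add: integral_diff)
    have "norm (?\<Gamma> y t - ?\<Gamma> z t) = norm ((U t 0 (u0 + h y) - U t 0 (u0 + h z)) +
        (integral {0..t} (\<lambda>s. U t s (?G y s)) - integral {0..t} (\<lambda>s. U t s (?G z s))))"
      using t by (simp add: Gamma_op_def algebra_simps)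
    also have "\<dots> \<le> M * L_h * ?d + M / \<delta> * K"
      using init rest by (intro order_trans[OF norm_triangle_ineq] add_mono)
    also have "\<dots> = \<xi>0 * ?d"
      by (simp add: \<xi>0 K_def algebra_simps add_divide_distrib)
    finally show "norm (?\<Gamma> y t - ?\<Gamma> z t) \<le> \<xi>0 * ?d" .
  qed

  \<comment> \<open>Invariance of \<open>Delta0\<close> and the fixed point\<close>
  have \<xi>0_nonneg: "0 \<le> \<xi>0"
    unfolding \<xi>0 using M \<delta> L_F L_h by simp
  have "y0 \<in> Delta0 y0 \<rho>"
    using y0_AAA \<rho> by (simp add: Delta0_def sup_dist_def)
  have "?\<Gamma> y \<in> Delta0 y0 \<rho>" if y: "y \<in> Delta0 y0 \<rho>" for y
  proof -
    have \<Gamma>y: "?\<Gamma> y \<in> AAA"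
      using Gamma y by (auto simp: Delta0_def)
    have "sup_dist (?\<Gamma> y) y0 \<le> sup_dist (?\<Gamma> y) (?\<Gamma> y0) + sup_dist (?\<Gamma> y0) y0"
      by (intro sup_dist_triangle \<Gamma>y \<Gamma>y0_AAA y0_AAA)
    also have "sup_dist (?\<Gamma> y) (?\<Gamma> y0) \<le> \<xi>0 * sup_dist y y0"
      using y \<open>y0 \<in> Delta0 y0 \<rho>\<close> by (rule contraction)
    also have "\<dots> \<le> \<xi>0 * \<rho>"
      using y \<xi>0_nonneg by (intro mult_left_mono) (auto simp: Delta0_def)
    also have "sup_dist (?\<Gamma> y0) y0 = (1 - \<xi>0) * \<theta>"
      using \<xi>0_less by (simp add: \<theta>)
    also have "\<dots> \<le> (1 - \<xi>0) * \<rho>"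
      using \<xi>0_less \<theta>_bounds(2) by (intro mult_left_mono) auto
    finally show ?thesis
      using \<Gamma>y by (simp add: Delta0_def algebra_simps)
  qed
  then have "\<exists>!y. y \<in> Delta0 y0 \<rho> \<and> ?\<Gamma> y = y"
    using \<rho> y0_AAA \<xi>0_nonneg \<xi>0_less contraction
    by (intro Delta0_fixed_point[of y0 \<rho> \<xi>0]) auto
  \<comment> \<open>Both \<open>y\<close> and its image are extensional, so the integral equation on
    the half-line is the same as equality of functions; membership in \<open>AAA\<close> supplies
    continuity and existence of the integrals.\<close>
  moreover have "mild_solution U B F h u0 y \<longleftrightarrow> ?\<Gamma> y = y" if y: "y \<in> AAA" for y
  proof -
    have "?\<Gamma> y = y \<longleftrightarrow> (\<forall>t\<ge>0. y t = ?\<Gamma> y t)"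
      using AAA_eqI[OF funcset_mem[OF Gamma y] y] by auto
    then show ?thesis
      using AAA_continuous[OF y] Gamma_defined[OF y] by (simp add: mild_solution_def Gamma_op_def)
  qed
  then have "y \<in> AAA \<and> mild_solution U B F h u0 y \<and> sup_dist y y0 \<le> \<rho> \<longleftrightarrow>
      y \<in> Delta0 y0 \<rho> \<and> ?\<Gamma> y = y" for y
    by (auto simp: Delta0_def)
  ultimately show ?thesis
    by simp
qed

end
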